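(* Let $R$ be a finite commutative local principal ideal ring with identity. If $F_0,F_1\in\mathrm{AGL}_1(R)$ do not commute, then the common centralizer $C(F_0)\cap C(F_1)$ is abelian, where $C(F)$ denotes the centralizer of $F$ in $\mathrm{AGL}_1(R)$. In particular, no cross-commuting nonabelian square exists in $\mathrm{AGL}_1(R)$.
   Context: For a commutative ring $R$ with identity, $\mathrm{AGL}_1(R)$ is the group (under composition) of affine permutations $x\mapsto ax+b$ of $R$ with $a\in R^\times$ and $b\in R$; identifying such a map with the pair $(a,b)$, the composition law is $(a,b)\circ(c,d)=(ac,ad+b)$. A principal ideal ring is a ring in which every ideal is principal (zero divisors are allowed). A cross-commuting nonabelian square in $\mathrm{AGL}_1(R)$ is a quadruple $(F_0,F_1,G_0,G_1)$ of elements of $\mathrm{AGL}_1(R)$ such that $F_i$ commutes with $G_j$ for all $i,j\in\{0,1\}$, but $F_0$ and $F_1$ do not commute, and $G_0$ and $G_1$ do not commute. *)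

theory Defs
  imports "HOL-Algebra.Algebra"
begin

section \<open>Local rings and principal ideal rings\<close>

locale local_cring = cring +
  assumes unique_maximalideal: "\<exists>!M. maximalideal M R"

text \<open>Unlike in the library locale \<^locale>\<open>principal_domain\<close>, zero divisors are allowed.\<close>

locale principal_ideal_cring = cring +
  assumes all_ideals_principal: "ideal I R \<Longrightarrow> principalideal I R"

section \<open>The affine group\<close>

text \<open>As in the library construction \<^const>\<open>BijGroup\<close>, a permutation of \<open>carrier R\<close> is represented by
  the function that is \<^const>\<open>undefined\<close> outside \<open>carrier R\<close>, so that equality in the group is
  equality of permutations.\<close>

definition affine_map :: "('a, 'm) ring_scheme \<Rightarrow> 'a \<Rightarrow> 'a \<Rightarrow> 'a \<Rightarrow> 'a"
  where "affine_map R a b = (\<lambda>x \<in> carrier R. a \<otimes>\<^bsub>R\<^esub> x \<oplus>\<^bsub>R\<^esub> b)"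

definition affine_perms :: "('a, 'm) ring_scheme \<Rightarrow> ('a \<Rightarrow> 'a) set"
  where "affine_perms R = {affine_map R a b | a b. a \<in> Units R \<and> b \<in> carrier R}"

definition AGL1 :: "('a, 'm) ring_scheme \<Rightarrow> ('a \<Rightarrow> 'a) monoid"
  where "AGL1 R = BijGroup (carrier R) \<lparr>carrier := affine_perms R\<rparr>"

definition commutes :: "('a, 'm) monoid_scheme \<Rightarrow> 'a \<Rightarrow> 'a \<Rightarrow> bool"
  where "commutes G x y \<longleftrightarrow> x \<otimes>\<^bsub>G\<^esub> y = y \<otimes>\<^bsub>G\<^esub> x"

definition centralizer :: "('a, 'm) monoid_scheme \<Rightarrow> 'a \<Rightarrow> 'a set"
  where "centralizer G x = {y \<in> carrier G. commutes G y x}"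

definition cross_commuting_nonabelian_square ::
    "('a, 'm) monoid_scheme \<Rightarrow> 'a \<Rightarrow> 'a \<Rightarrow> 'a \<Rightarrow> 'a \<Rightarrow> bool"
  where "cross_commuting_nonabelian_square G F\<^sub>0 F\<^sub>1 G\<^sub>0 G\<^sub>1 \<longleftrightarrow>
    {F\<^sub>0, F\<^sub>1, G\<^sub>0, G\<^sub>1} \<subseteq> carrier G \<and>
    (\<forall>F \<in> {F\<^sub>0, F\<^sub>1}. \<forall>H \<in> {G\<^sub>0, G\<^sub>1}. commutes G F H) \<and>
    \<not> commutes G F\<^sub>0 F\<^sub>1 \<and> \<not> commutes G G\<^sub>0 G\<^sub>1"

section \<open>The affine permutations form a group\<close>

context cring
begin

lemma affine_map_compose:
  assumes "a \<in> carrier R" "b \<in> carrier R" "c \<in> carrier R" "d \<in> carrier R"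
  shows "compose (carrier R) (affine_map R a b) (affine_map R c d)
    = affine_map R (a \<otimes> c) (a \<otimes> d \<oplus> b)"
  using assms by (auto simp: affine_map_def compose_def restrict_def fun_eq_iff m_assoc r_distr a_assoc)

lemma affine_map_one_zero: "affine_map R \<one> \<zero> = (\<lambda>x \<in> carrier R. x)"
  by (auto simp: affine_map_def restrict_def fun_eq_iff)

lemma affine_map_inverse:
  assumes "a \<in> Units R" "b \<in> carrier R"
  shows "compose (carrier R) (affine_map R (inv a) (\<ominus> (inv a \<otimes> b))) (affine_map R a b) = (\<lambda>x \<in> carrier R. x)"
    and "compose (carrier R) (affine_map R a b) (affine_map R (inv a) (\<ominus> (inv a \<otimes> b))) = (\<lambda>x \<in> carrier R. x)"
proof -
  have "a \<in> carrier R" "inv a \<in> carrier R" "inv a \<otimes> a = \<one>" "a \<otimes> inv a = \<one>"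
    using assms by auto
  moreover from this have "a \<otimes> (\<ominus> (inv a \<otimes> b)) \<oplus> b = \<zero>"
    using assms(2) by (simp add: r_minus m_assoc[symmetric] l_neg)
  ultimately show
    "compose (carrier R) (affine_map R (inv a) (\<ominus> (inv a \<otimes> b))) (affine_map R a b) = (\<lambda>x \<in> carrier R. x)"
    "compose (carrier R) (affine_map R a b) (affine_map R (inv a) (\<ominus> (inv a \<otimes> b))) = (\<lambda>x \<in> carrier R. x)"
    using assms(2) by (simp_all add: affine_map_compose affine_map_one_zero[symmetric] r_neg)
qed

lemma affine_map_Bij:
  assumes "a \<in> Units R" "b \<in> carrier R"
  shows "affine_map R a b \<in> Bij (carrier R)"
proof -
  let ?f = "affine_map R a b" and ?g = "affine_map R (inv a) (\<ominus> (inv a \<otimes> b))"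
  have "\<And>x. x \<in> carrier R \<Longrightarrow> ?f x \<in> carrier R" "\<And>x. x \<in> carrier R \<Longrightarrow> ?g x \<in> carrier R"
    using assms by (auto simp: affine_map_def)
  moreover have "\<And>x. x \<in> carrier R \<Longrightarrow> ?g (?f x) = x" "\<And>x. x \<in> carrier R \<Longrightarrow> ?f (?g x) = x"
    using affine_map_inverse[OF assms] by (metis compose_eq restrict_apply')+
  ultimately have "bij_betw ?f (carrier R) (carrier R)"
    by (intro bij_betw_byWitness[where f' = ?g]) auto
  then show ?thesis
    by (simp add: Bij_def affine_map_def)
qed

lemma affine_perms_subgroup: "subgroup (affine_perms R) (BijGroup (carrier R))"
proof (rule group.subgroupI[OF group_BijGroup])
  show "affine_perms R \<subseteq> carrier (BijGroup (carrier R))"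
    by (auto simp: affine_perms_def BijGroup_def affine_map_Bij)
  show "affine_perms R \<noteq> {}"
    by (auto simp: affine_perms_def)
next
  fix f assume "f \<in> affine_perms R"
  then obtain a b where f: "f = affine_map R a b" "a \<in> Units R" "b \<in> carrier R"
    by (auto simp: affine_perms_def)
  let ?g = "affine_map R (inv a) (\<ominus> (inv a \<otimes> b))"
  have ab: "inv a \<in> Units R" "\<ominus> (inv a \<otimes> b) \<in> carrier R"
    using f by auto
  then have g: "?g \<in> affine_perms R" "?g \<in> Bij (carrier R)"
    unfolding affine_perms_def by (blast, rule affine_map_Bij)
  have "inv\<^bsub>BijGroup (carrier R)\<^esub> f = ?g"
    using f g affine_map_Bij[of a b] affine_map_inverse[of a b]
    by (intro group.inv_equality[OF group_BijGroup]) (simp_all add: BijGroup_def)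
  then show "inv\<^bsub>BijGroup (carrier R)\<^esub> f \<in> affine_perms R"
    using g by simp
next
  fix f h assume "f \<in> affine_perms R" "h \<in> affine_perms R"
  then obtain a b c d where f: "f = affine_map R a b" "a \<in> Units R" "b \<in> carrier R"
    and h: "h = affine_map R c d" "c \<in> Units R" "d \<in> carrier R"
    by (auto simp: affine_perms_def)
  then have "f \<otimes>\<^bsub>BijGroup (carrier R)\<^esub> h = affine_map R (a \<otimes> c) (a \<otimes> d \<oplus> b)"
    by (simp add: BijGroup_def affine_map_Bij affine_map_compose Units_closed)
  moreover have "a \<otimes> c \<in> Units R" "a \<otimes> d \<oplus> b \<in> carrier R"
    using f h by auto
  ultimately show "f \<otimes>\<^bsub>BijGroup (carrier R)\<^esub> h \<in> affine_perms R"
    unfolding affine_perms_def by blast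
qed

theorem AGL1_group: "group (AGL1 R)"
  unfolding AGL1_def by (rule group.subgroup_imp_group[OF group_BijGroup affine_perms_subgroup])

lemma AGL1_mult:
  assumes "a \<in> Units R" "b \<in> carrier R" "c \<in> Units R" "d \<in> carrier R"
  shows "affine_map R a b \<otimes>\<^bsub>AGL1 R\<^esub> affine_map R c d = affine_map R (a \<otimes> c) (a \<otimes> d \<oplus> b)"
  using assms by (simp add: AGL1_def BijGroup_def affine_map_Bij affine_map_compose Units_closed)

end

end

theory Submission
  imports Defs
begin

text \<open>Put \<open>u = a - 1\<close> for an affine map \<open>x \<mapsto> a x + b\<close>. Two maps commute iff the vectors \<open>(u, b)\<close>,
  \<open>(v, d)\<close> have vanishing determinant \<open>u d - v b\<close>. In a local principal ideal ring any two elements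
  are comparable for divisibility, so one of the four coordinates of \<open>F\<^sub>0, F\<^sub>1\<close>, say the first
  coordinate \<open>p\<close> of \<open>F\<^sub>0\<close>, divides the other three; write \<open>F\<^sub>0 = (p, p b)\<close> and \<open>F\<^sub>1 = (p c, p f)\<close>.
  Let \<open>(v, d)\<close> be orthogonal to both. If \<open>p = v t\<close>, then
  \<open>p (p f) = t (v p f) = t (p c d) = t c (v p b) = (p c) (p b)\<close>, so \<open>F\<^sub>0\<close> and \<open>F\<^sub>1\<close> commute. Otherwise
  \<open>p\<close> divides \<open>v\<close>, and for two such vectors \<open>v\<^sub>i = p q\<^sub>i\<close> the products \<open>v\<^sub>0 d\<^sub>1\<close> and \<open>v\<^sub>1 d\<^sub>0\<close> both
  equal \<open>q\<^sub>0 q\<^sub>1 p (p b)\<close>.\<close>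

section \<open>Divisibility in local principal ideal rings\<close>

text \<open>Zorn's lemma, applied to the ideals that contain \<open>I\<close> and avoid
  \<open>\<one>\<close>: avoiding \<open>\<one>\<close> is the form of properness that visibly
  survives unions of chains.\<close>

lemma (in ring) proper_ideal_subset_maximalideal:
  assumes "ideal I R" "I \<noteq> carrier R"
  obtains M where "maximalideal M R" "I \<subseteq> M"
proof -
  define A where "A = {J. ideal J R \<and> I \<subseteq> J \<and> \<one> \<notin> J}"
  have "\<one> \<notin> I"
    using assms ideal.one_imp_carrier by blast
  have "\<exists>M\<in>A. \<forall>J\<in>A. M \<subseteq> J \<longrightarrow> J = M"
  proof (rule subset_Zorn_nonempty)
    show "A \<noteq> {}"
      using assms(1) \<open>\<one> \<notin> I\<close> by (auto simp: A_def)
  next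
    fix C assume C: "C \<noteq> {}" "subset.chain A C"
    then have "subset.chain {J. ideal J R} C"
      by (auto simp: pred_on.chain_def A_def)
    then have "ideal (\<Union>C) R"
      using chain_Union_is_ideal[of C] C(1) by simp
    then show "\<Union>C \<in> A"
      using C by (auto simp: pred_on.chain_def A_def)
  qed
  then obtain M where "M \<in> A" and max: "\<forall>J\<in>A. M \<subseteq> J \<longrightarrow> J = M"
    by (rule bexE)
  then have M: "ideal M R" "I \<subseteq> M" "\<one> \<notin> M"
    by (simp_all add: A_def)
  have "maximalideal M R"
  proof (rule maximalidealI[OF M(1)])
    show "carrier R \<noteq> M"
      using M(3) by blast
    show "J = M \<or> J = carrier R" if "ideal J R" "M \<subseteq> J" for J
    proof (cases "\<one> \<in> J")
      case True
      then show ?thesis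
        using ideal.one_imp_carrier that(1) by blast
    next
      case False
      then have "J \<in> A"
        using that M(2) by (simp add: A_def)
      then show ?thesis
        using max that(2) by simp
    qed
  qed
  with M(2) show thesis
    using that by blast
qed

text \<open>A nonunit generates a proper ideal, which lies in some maximal ideal and hence in the
  only one. In \<open>divides_linear\<close> this keeps a combination of nonunits inside the maximal
  ideal.\<close>

lemma (in local_cring) maximalideal_nonunits:
  obtains M where "maximalideal M R" "M = carrier R - Units R"
proof -
  obtain M where M: "maximalideal M R" and unique: "\<And>N. maximalideal N R \<Longrightarrow> N = M"
    using unique_maximalideal by blast
  interpret maximalideal M R by (fact M)
  have "x \<in> M" if x: "x \<in> carrier R" "x \<notin> Units R" for x
  proof -
    have "\<one> \<notin> PIdl x"
    proof
      assume "\<one> \<in> PIdl x"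
      then obtain y where y: "y \<in> carrier R" "y \<otimes> x = \<one>"
        by (auto simp: cgenideal_def)
      then show False
        using x Units_inv_comm[of y x] by (auto simp: Units_def m_comm)
    qed
    then have "PIdl x \<noteq> carrier R"
      by blast
    then have "PIdl x \<subseteq> M"
      using proper_ideal_subset_maximalideal cgenideal_ideal x(1) unique by metis
    then show ?thesis
      using cgenideal_self x(1) by blast
  qed
  moreover have "x \<notin> Units R" if x: "x \<in> M" for x
  proof
    assume "x \<in> Units R"
    then have "\<one> \<in> M"
      using I_l_closed[OF x, of "inv x"] by simp
    then show False
      using one_imp_carrier I_notcarr by blast
  qed
  ultimately have "M = carrier R - Units R"
    using a_subset by blast
  with M show thesis
    using that by blast
qed

text \<open>The sum of the two principal ideals is principal, and \<open>g\<close> generates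
  it.\<close>

lemma (in principal_ideal_cring) bezout:
  assumes "x \<in> carrier R" "y \<in> carrier R"
  obtains g x' y' s t where "{g, x', y', s, t} \<subseteq> carrier R"
    "x = g \<otimes> x'" "y = g \<otimes> y'" "g = x \<otimes> s \<oplus> y \<otimes> t"
proof -
  have I: "ideal (PIdl x <+>\<^bsub>R\<^esub> PIdl y) R"
    using add_ideals cgenideal_ideal assms by blast
  have mem: "z \<in> PIdl x <+>\<^bsub>R\<^esub> PIdl y \<longleftrightarrow> (\<exists>s\<in>carrier R. \<exists>t\<in>carrier R. z = x \<otimes> s \<oplus> y \<otimes> t)" for z
    using assms by (auto simp: set_add_def' cgenideal_def) (metis m_comm)+
  obtain g where g: "g \<in> carrier R" "PIdl x <+>\<^bsub>R\<^esub> PIdl y = PIdl g"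
    using principalideal.generate[OF all_ideals_principal[OF I]] cgenideal_eq_genideal by metis
  have "x = x \<otimes> \<one> \<oplus> y \<otimes> \<zero>" "y = x \<otimes> \<zero> \<oplus> y \<otimes> \<one>"
    using assms by auto
  then have "x \<in> PIdl g" "y \<in> PIdl g"
    using mem unfolding g(2)[symmetric] by blast+
  then obtain x' y' where "x' \<in> carrier R" "x = g \<otimes> x'" "y' \<in> carrier R" "y = g \<otimes> y'"
    using g(1) by (auto simp: cgenideal_def) (metis m_comm)
  moreover obtain s t where "s \<in> carrier R" "t \<in> carrier R" "g = x \<otimes> s \<oplus> y \<otimes> t"
    using mem[of g] g cgenideal_self by auto
  ultimately show thesis
    using that g(1) by blast
qed

locale local_principal_ideal_cring = local_cring + principal_ideal_cring
begin

text \<open>Substituting the factorizations into the Bezout relation gives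
  \<open>g = g \<otimes> ?m\<close>. If neither cofactor is a unit, \<open>?m\<close> lies in the
  maximal ideal, so \<open>\<one> \<ominus> ?m\<close> is a unit and \<open>g = \<zero>\<close>. If
  one is a unit, its product with \<open>g\<close> is an associate of \<open>g\<close> and divides
  the other.\<close>

lemma divides_linear:
  assumes "x \<in> carrier R" "y \<in> carrier R"
  shows "x divides y \<or> y divides x"
proof -
  obtain g x' y' s t where closed: "{g, x', y', s, t} \<subseteq> carrier R"
    and x: "x = g \<otimes> x'" and y: "y = g \<otimes> y'" and g: "g = x \<otimes> s \<oplus> y \<otimes> t"
    using bezout[OF assms] by metis
  have unit: "g \<otimes> a divides g \<otimes> b" if "a \<in> Units R" "b \<in> carrier R" for a b
  proof (rule dividesI)
    show "inv a \<otimes> b \<in> carrier R"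
      using that by simp
    have "a \<otimes> (inv a \<otimes> b) = b"
      using that by (simp add: m_assoc[symmetric] Units_closed)
    then show "g \<otimes> b = g \<otimes> a \<otimes> (inv a \<otimes> b)"
      using that closed by (simp add: m_assoc Units_closed)
  qed
  show ?thesis
  proof (cases "x' \<in> Units R \<or> y' \<in> Units R")
    case True
    then show ?thesis
      using unit closed x y by auto
  next
    case False
    obtain M where M: "maximalideal M R" "M = carrier R - Units R"
      by (rule maximalideal_nonunits)
    interpret maximalideal M R by (fact M)
    let ?m = "x' \<otimes> s \<oplus> y' \<otimes> t"
    have "x' \<in> M" "y' \<in> M"
      using False M(2) closed by auto
    then have m: "?m \<in> M"
      using closed by (auto intro: I_r_closed)
    then have m_closed: "?m \<in> carrier R"
      by (rule a_Hcarr)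
    have "\<one> \<ominus> ?m \<notin> M"
    proof
      assume "\<one> \<ominus> ?m \<in> M"
      then have "(\<one> \<ominus> ?m) \<oplus> ?m \<in> M"
        using m by simp
      moreover have "(\<one> \<ominus> ?m) \<oplus> ?m = \<one>"
        using m_closed by (simp add: a_minus_def a_assoc l_neg)
      ultimately show False
        using one_imp_carrier I_notcarr by auto
    qed
    then have u: "\<one> \<ominus> ?m \<in> Units R"
      using M(2) minus_closed[OF one_closed m_closed] by blast
    have "x \<otimes> s \<oplus> y \<otimes> t = g \<otimes> ?m"
      unfolding x y using closed by (simp add: r_distr m_assoc)
    then have "g \<otimes> ?m = g"
      using g by metis
    then have "g \<otimes> (\<one> \<ominus> ?m) = \<zero>"
      using closed m_closed by (simp add: a_minus_def r_distr r_minus r_neg)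
    \<comment> \<open>\<open>Units_r_inv\<close> would cancel the unit against its inverse before
      \<open>m_assoc\<close> can regroup the product to expose
      \<open>g \<otimes> (\<one> \<ominus> ?m)\<close>.\<close>
    then have "g \<otimes> ((\<one> \<ominus> ?m) \<otimes> inv (\<one> \<ominus> ?m)) = \<zero>"
      using u closed by (simp add: m_assoc[symmetric] del: Units_r_inv)
    then have "g = \<zero>"
      using u closed by simp
    then have "x = y \<otimes> \<zero>"
      using x y closed by simp
    then show ?thesis
      using dividesI[of "\<zero>" R x y] by simp
  qed
qed

text \<open>Zero divisors forbid cancelling \<open>p\<close>, so it stays in every equation; it is
  absorbed by \<open>v\<^sub>0\<close> and \<open>v\<^sub>1\<close> once it is known to divide
  them.\<close>

lemma dets_vanish_pivot:
  assumes closed: "{p, b, c, f, v\<^sub>0, d\<^sub>0, v\<^sub>1, d\<^sub>1} \<subseteq> carrier R"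
    and F: "p \<otimes> (p \<otimes> f) \<noteq> (p \<otimes> c) \<otimes> (p \<otimes> b)"
    and G\<^sub>0: "p \<otimes> d\<^sub>0 = v\<^sub>0 \<otimes> (p \<otimes> b)" "(p \<otimes> c) \<otimes> d\<^sub>0 = v\<^sub>0 \<otimes> (p \<otimes> f)"
    and G\<^sub>1: "p \<otimes> d\<^sub>1 = v\<^sub>1 \<otimes> (p \<otimes> b)" "(p \<otimes> c) \<otimes> d\<^sub>1 = v\<^sub>1 \<otimes> (p \<otimes> f)"
  shows "v\<^sub>0 \<otimes> d\<^sub>1 = v\<^sub>1 \<otimes> d\<^sub>0"
proof -
  have pv: "p divides v" if v: "v \<in> carrier R" "d \<in> carrier R"
    "p \<otimes> d = v \<otimes> (p \<otimes> b)" "(p \<otimes> c) \<otimes> d = v \<otimes> (p \<otimes> f)" for v d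
  proof (rule ccontr)
    assume "\<not> p divides v"
    then have "v divides p"
      using divides_linear v(1) closed by blast
    then obtain t where t: "t \<in> carrier R" "p = v \<otimes> t"
      by (rule dividesE)
    \<comment> \<open>Only one of the two factors \<open>p\<close> is expanded; the other is needed
      to form \<open>v \<otimes> (p \<otimes> f)\<close>, to which the second equation
      applies.\<close>
    have "p \<otimes> (p \<otimes> f) = t \<otimes> (v \<otimes> (p \<otimes> f))"
      using t v(1) closed by (subst t(2)) (simp add: m_ac)
    also have "\<dots> = (t \<otimes> c) \<otimes> (p \<otimes> d)"
      unfolding v(4)[symmetric] using t(1) v(2) closed by (simp add: m_ac)
    also have "\<dots> = (c \<otimes> (v \<otimes> t)) \<otimes> (p \<otimes> b)"
      unfolding v(3) using t(1) v(1) closed by (simp add: m_ac)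
    also have "\<dots> = (p \<otimes> c) \<otimes> (p \<otimes> b)"
      unfolding t(2)[symmetric] using closed by (simp add: m_ac)
    finally show False
      using F by blast
  qed
  obtain q\<^sub>0 where q\<^sub>0: "q\<^sub>0 \<in> carrier R" "v\<^sub>0 = p \<otimes> q\<^sub>0"
    using pv[OF _ _ G\<^sub>0] closed by auto
  obtain q\<^sub>1 where q\<^sub>1: "q\<^sub>1 \<in> carrier R" "v\<^sub>1 = p \<otimes> q\<^sub>1"
    using pv[OF _ _ G\<^sub>1] closed by auto
  have "v\<^sub>0 \<otimes> d\<^sub>1 = q\<^sub>0 \<otimes> (p \<otimes> d\<^sub>1)"
    using q\<^sub>0 closed by (simp add: m_ac)
  also have "\<dots> = q\<^sub>1 \<otimes> (v\<^sub>0 \<otimes> (p \<otimes> b))"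
    unfolding G\<^sub>1(1) unfolding q\<^sub>0(2) q\<^sub>1(2) using q\<^sub>0(1) q\<^sub>1(1) closed by (simp add: m_ac)
  also have "\<dots> = v\<^sub>1 \<otimes> d\<^sub>0"
    unfolding G\<^sub>0(1)[symmetric] unfolding q\<^sub>1(2) using q\<^sub>1(1) closed by (simp add: m_ac)
  finally show ?thesis .
qed

text \<open>Swapping the two coordinates everywhere, or \<open>(u\<^sub>0, b\<^sub>0)\<close> with
  \<open>(u\<^sub>1, b\<^sub>1)\<close>, permutes the determinants up to sign, so whichever entry
  divides the others can be moved to the pivot position.\<close>

lemma dets_vanish:
  assumes closed: "{u\<^sub>0, b\<^sub>0, u\<^sub>1, b\<^sub>1, v\<^sub>0, d\<^sub>0, v\<^sub>1, d\<^sub>1} \<subseteq> carrier R"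
    and F: "u\<^sub>0 \<otimes> b\<^sub>1 \<noteq> u\<^sub>1 \<otimes> b\<^sub>0"
    and G\<^sub>0: "u\<^sub>0 \<otimes> d\<^sub>0 = v\<^sub>0 \<otimes> b\<^sub>0" "u\<^sub>1 \<otimes> d\<^sub>0 = v\<^sub>0 \<otimes> b\<^sub>1"
    and G\<^sub>1: "u\<^sub>0 \<otimes> d\<^sub>1 = v\<^sub>1 \<otimes> b\<^sub>0" "u\<^sub>1 \<otimes> d\<^sub>1 = v\<^sub>1 \<otimes> b\<^sub>1"
  shows "v\<^sub>0 \<otimes> d\<^sub>1 = v\<^sub>1 \<otimes> d\<^sub>0"
proof -
  have pivot: "w\<^sub>0 \<otimes> e\<^sub>1 = w\<^sub>1 \<otimes> e\<^sub>0"
    if "{p, q, r, s, w\<^sub>0, e\<^sub>0, w\<^sub>1, e\<^sub>1} \<subseteq> carrier R" and dvd: "p divides q" "p divides r" "p divides s"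
      and "p \<otimes> s \<noteq> r \<otimes> q" "p \<otimes> e\<^sub>0 = w\<^sub>0 \<otimes> q" "r \<otimes> e\<^sub>0 = w\<^sub>0 \<otimes> s" "p \<otimes> e\<^sub>1 = w\<^sub>1 \<otimes> q" "r \<otimes> e\<^sub>1 = w\<^sub>1 \<otimes> s"
    for p q r s w\<^sub>0 e\<^sub>0 w\<^sub>1 e\<^sub>1
  proof -
    obtain b c f where "b \<in> carrier R" "q = p \<otimes> b" "c \<in> carrier R" "r = p \<otimes> c" "f \<in> carrier R" "s = p \<otimes> f"
      using dvd by (auto elim!: dividesE)
    then show ?thesis
      using that dets_vanish_pivot[of p b c f w\<^sub>0 e\<^sub>0 w\<^sub>1 e\<^sub>1] by auto
  qed
  have min: "\<exists>p\<in>{x, y}. p divides x \<and> p divides y" if "{x, y} \<subseteq> carrier R" for x y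
    using divides_linear that by auto
  \<comment> \<open>A knockout: \<open>x\<close> wins in the first vector, \<open>y\<close> in the
    second, and the winner \<open>p\<close> of the final divides all four entries by
    transitivity.\<close>
  obtain x where x: "x \<in> {u\<^sub>0, b\<^sub>0}" "x divides u\<^sub>0" "x divides b\<^sub>0"
    using min[of u\<^sub>0 b\<^sub>0] closed by auto
  obtain y where y: "y \<in> {u\<^sub>1, b\<^sub>1}" "y divides u\<^sub>1" "y divides b\<^sub>1"
    using min[of u\<^sub>1 b\<^sub>1] closed by auto
  have "{x, y} \<subseteq> carrier R"
    using x(1) y(1) closed by auto
  then obtain p where p_mem: "p \<in> {x, y}" and "p divides x" "p divides y" and "p \<in> carrier R"
    using min[of x y] by auto
  then have p: "p divides u\<^sub>0" "p divides b\<^sub>0" "p divides u\<^sub>1" "p divides b\<^sub>1"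
    using x(2,3) y(2,3) divides_trans by metis+
  \<comment> \<open>The hypotheses with the coordinates exchanged in all four vectors.\<close>
  have swap: "b\<^sub>0 \<otimes> u\<^sub>1 \<noteq> b\<^sub>1 \<otimes> u\<^sub>0"
    "b\<^sub>0 \<otimes> v\<^sub>0 = d\<^sub>0 \<otimes> u\<^sub>0" "b\<^sub>1 \<otimes> v\<^sub>0 = d\<^sub>0 \<otimes> u\<^sub>1"
    "b\<^sub>0 \<otimes> v\<^sub>1 = d\<^sub>1 \<otimes> u\<^sub>0" "b\<^sub>1 \<otimes> v\<^sub>1 = d\<^sub>1 \<otimes> u\<^sub>1"
    using F G\<^sub>0 G\<^sub>1 closed m_comm[of b\<^sub>0] m_comm[of b\<^sub>1] m_comm[of d\<^sub>0] m_comm[of d\<^sub>1] by simp_all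
  have swap_back: "v\<^sub>0 \<otimes> d\<^sub>1 = v\<^sub>1 \<otimes> d\<^sub>0" if "d\<^sub>0 \<otimes> v\<^sub>1 = d\<^sub>1 \<otimes> v\<^sub>0"
    using that closed m_comm[of d\<^sub>0 v\<^sub>1] m_comm[of d\<^sub>1 v\<^sub>0] by simp
  consider "p = u\<^sub>0" | "p = b\<^sub>0" | "p = u\<^sub>1" | "p = b\<^sub>1"
    using p_mem x(1) y(1) by blast
  then show ?thesis
  proof cases
    case 1
    show ?thesis
      using closed p[unfolded 1] F G\<^sub>0 G\<^sub>1
      by - (rule pivot[of u\<^sub>0 b\<^sub>0 u\<^sub>1 b\<^sub>1], blast+)
  next
    case 2
    show ?thesis
      using closed p[unfolded 2] swap
      by - (rule swap_back, rule pivot[of b\<^sub>0 u\<^sub>0 b\<^sub>1 u\<^sub>1], blast+)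
  next
    \<comment> \<open>Here the two vectors trade places; the last case combines both
      symmetries.\<close>
    case 3
    show ?thesis
      using closed p[unfolded 3] F[symmetric] G\<^sub>0 G\<^sub>1
      by - (rule pivot[of u\<^sub>1 b\<^sub>1 u\<^sub>0 b\<^sub>0], blast+)
  next
    case 4
    show ?thesis
      using closed p[unfolded 4] swap(1)[symmetric] swap
      by - (rule swap_back, rule pivot[of b\<^sub>1 u\<^sub>1 b\<^sub>0 u\<^sub>0], blast+)
  qed
qed

end

section \<open>Centralizers in the affine group\<close>

text \<open>Makes the common centralizer, an intersection of subgroups, a group in its own right, as
  \<open>comm_group\<close> demands.\<close>

lemma (in group) centralizer_subgroup:
  assumes x: "x \<in> carrier G"
  shows "subgroup (centralizer G x) G"
proof (rule subgroupI)
  show "centralizer G x \<subseteq> carrier G"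
    by (auto simp: centralizer_def)
  show "centralizer G x \<noteq> {}"
    using x by (auto simp: centralizer_def commutes_def)
next
  fix y assume "y \<in> centralizer G x"
  then have y: "y \<in> carrier G" "y \<otimes> x = x \<otimes> y"
    by (auto simp: centralizer_def commutes_def)
  have "inv y \<otimes> x = inv y \<otimes> (x \<otimes> y) \<otimes> inv y"
    using x y(1) by (simp add: m_assoc)
  also have "\<dots> = x \<otimes> inv y"
    unfolding y(2)[symmetric] using x y(1) by (simp add: m_assoc[symmetric])
  finally show "inv y \<in> centralizer G x"
    using y(1) by (simp add: centralizer_def commutes_def)
next
  fix y z assume "y \<in> centralizer G x" "z \<in> centralizer G x"
  then have yz: "y \<in> carrier G" "z \<in> carrier G" "y \<otimes> x = x \<otimes> y" "z \<otimes> x = x \<otimes> z"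
    by (auto simp: centralizer_def commutes_def)
  have "y \<otimes> z \<otimes> x = y \<otimes> x \<otimes> z"
    using x yz(1,2,4) by (simp add: m_assoc)
  then show "y \<otimes> z \<in> centralizer G x"
    using x yz by (simp add: centralizer_def commutes_def m_assoc)
qed

context cring
begin

lemma AGL1_carrier: "carrier (AGL1 R) = affine_perms R"
  by (simp add: AGL1_def)

text \<open>The linear parts of the two composites agree since the ring is commutative, so only
  their constant terms need comparing; removing \<open>b \<oplus> d\<close> from both leaves the
  determinant condition.\<close>

lemma commutes_affine_map_iff:
  assumes "a \<in> Units R" "b \<in> carrier R" "c \<in> Units R" "d \<in> carrier R"
  shows "commutes (AGL1 R) (affine_map R a b) (affine_map R c d) \<longleftrightarrow>
    (a \<ominus> \<one>) \<otimes> d = (c \<ominus> \<one>) \<otimes> b"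
proof -
  have closed: "a \<in> carrier R" "c \<in> carrier R"
    using assms by auto
  \<comment> \<open>Evaluation at \<open>\<zero>\<close> recovers the translation part.\<close>
  have snd_eq: "y = y'" if "affine_map R x y = affine_map R x y'"
    "x \<in> carrier R" "y \<in> carrier R" "y' \<in> carrier R" for x y y'
    using fun_cong[OF that(1), of \<zero>] that(2-) by (simp add: affine_map_def)
  have split: "x \<otimes> y = (x \<ominus> \<one>) \<otimes> y \<oplus> y" if "x \<in> carrier R" "y \<in> carrier R" for x y
    using that by (simp add: a_minus_def l_distr l_minus a_assoc l_neg)
  have "commutes (AGL1 R) (affine_map R a b) (affine_map R c d) \<longleftrightarrow>
    affine_map R (a \<otimes> c) (a \<otimes> d \<oplus> b) = affine_map R (a \<otimes> c) (c \<otimes> b \<oplus> d)"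
    using assms closed by (simp add: commutes_def AGL1_mult m_comm)
  also have "\<dots> \<longleftrightarrow> a \<otimes> d \<oplus> b = c \<otimes> b \<oplus> d"
    using snd_eq[of "a \<otimes> c"] assms closed by auto
  also have "\<dots> \<longleftrightarrow> (a \<ominus> \<one>) \<otimes> d \<oplus> (b \<oplus> d) = (c \<ominus> \<one>) \<otimes> b \<oplus> (b \<oplus> d)"
    using split[of a d] split[of c b] assms closed by (simp add: a_ac)
  also have "\<dots> \<longleftrightarrow> (a \<ominus> \<one>) \<otimes> d = (c \<ominus> \<one>) \<otimes> b"
    using assms closed by (intro iffI) (auto dest: add.r_cancel)
  finally show ?thesis .
qed

end

text \<open>The common core of both claims of the theorem: \<open>dets_vanish\<close> carried over
  from vectors to affine maps.\<close>

lemma (in local_principal_ideal_cring) commutes_of_commutes_noncommuting: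
  assumes carr: "{F\<^sub>0, F\<^sub>1, G\<^sub>0, G\<^sub>1} \<subseteq> carrier (AGL1 R)"
    and F: "\<not> commutes (AGL1 R) F\<^sub>0 F\<^sub>1"
    and G: "commutes (AGL1 R) F\<^sub>0 G\<^sub>0" "commutes (AGL1 R) F\<^sub>1 G\<^sub>0"
      "commutes (AGL1 R) F\<^sub>0 G\<^sub>1" "commutes (AGL1 R) F\<^sub>1 G\<^sub>1"
  shows "commutes (AGL1 R) G\<^sub>0 G\<^sub>1"
proof -
  have rep: "\<exists>a b. F = affine_map R a b \<and> a \<in> Units R \<and> b \<in> carrier R" if "F \<in> carrier (AGL1 R)" for F
    using that by (auto simp: AGL1_carrier affine_perms_def)
  obtain a\<^sub>0 b\<^sub>0 where F\<^sub>0: "F\<^sub>0 = affine_map R a\<^sub>0 b\<^sub>0" "a\<^sub>0 \<in> Units R" "b\<^sub>0 \<in> carrier R"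
    using rep carr by blast
  obtain a\<^sub>1 b\<^sub>1 where F\<^sub>1: "F\<^sub>1 = affine_map R a\<^sub>1 b\<^sub>1" "a\<^sub>1 \<in> Units R" "b\<^sub>1 \<in> carrier R"
    using rep carr by blast
  obtain c\<^sub>0 d\<^sub>0 where G\<^sub>0: "G\<^sub>0 = affine_map R c\<^sub>0 d\<^sub>0" "c\<^sub>0 \<in> Units R" "d\<^sub>0 \<in> carrier R"
    using rep carr by blast
  obtain c\<^sub>1 d\<^sub>1 where G\<^sub>1: "G\<^sub>1 = affine_map R c\<^sub>1 d\<^sub>1" "c\<^sub>1 \<in> Units R" "d\<^sub>1 \<in> carrier R"
    using rep carr by blast
  \<comment> \<open>These rules turn each commutation hypothesis into a determinant condition on the
    vectors formed from \<open>a\<^sub>i \<ominus> \<one>\<close>, \<open>b\<^sub>i\<close> and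
    \<open>c\<^sub>j \<ominus> \<one>\<close>, \<open>d\<^sub>j\<close>.\<close>
  note [simp] = F\<^sub>0 F\<^sub>1 G\<^sub>0 G\<^sub>1 commutes_affine_map_iff
  have "(c\<^sub>0 \<ominus> \<one>) \<otimes> d\<^sub>1 = (c\<^sub>1 \<ominus> \<one>) \<otimes> d\<^sub>0"
  proof (rule dets_vanish)
    show "{a\<^sub>0 \<ominus> \<one>, b\<^sub>0, a\<^sub>1 \<ominus> \<one>, b\<^sub>1, c\<^sub>0 \<ominus> \<one>, d\<^sub>0, c\<^sub>1 \<ominus> \<one>, d\<^sub>1} \<subseteq> carrier R"
      by (simp add: Units_closed)
  qed (use F G in simp_all)
  then show ?thesis
    by simp
qed

theorem theorem3p1:
  fixes R :: "('a, 'm) ring_scheme"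
  assumes "local_cring R"
    and "principal_ideal_cring R"
    and "finite (carrier R)"
  shows "(\<forall>F\<^sub>0 \<in> carrier (AGL1 R). \<forall>F\<^sub>1 \<in> carrier (AGL1 R).
            \<not> commutes (AGL1 R) F\<^sub>0 F\<^sub>1 \<longrightarrow>
            comm_group (AGL1 R \<lparr>carrier := centralizer (AGL1 R) F\<^sub>0 \<inter> centralizer (AGL1 R) F\<^sub>1\<rparr>))
       \<and> \<not> (\<exists>F\<^sub>0 F\<^sub>1 G\<^sub>0 G\<^sub>1. cross_commuting_nonabelian_square (AGL1 R) F\<^sub>0 F\<^sub>1 G\<^sub>0 G\<^sub>1)"
proof -
  interpret local_principal_ideal_cring R
    by (intro local_principal_ideal_cring.intro assms)
  interpret AGL1: group "AGL1 R"
    by (rule AGL1_group)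
  have "comm_group (AGL1 R \<lparr>carrier := centralizer (AGL1 R) F\<^sub>0 \<inter> centralizer (AGL1 R) F\<^sub>1\<rparr>)"
    if F: "F\<^sub>0 \<in> carrier (AGL1 R)" "F\<^sub>1 \<in> carrier (AGL1 R)" "\<not> commutes (AGL1 R) F\<^sub>0 F\<^sub>1" for F\<^sub>0 F\<^sub>1
  proof (rule group.group_comm_groupI)
    show "group (AGL1 R \<lparr>carrier := centralizer (AGL1 R) F\<^sub>0 \<inter> centralizer (AGL1 R) F\<^sub>1\<rparr>)"
      using F AGL1.centralizer_subgroup AGL1.subgroups_Inter_pair AGL1.subgroup_imp_group by blast
  next
    fix x y
    assume "x \<in> carrier (AGL1 R \<lparr>carrier := centralizer (AGL1 R) F\<^sub>0 \<inter> centralizer (AGL1 R) F\<^sub>1\<rparr>)"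
      "y \<in> carrier (AGL1 R \<lparr>carrier := centralizer (AGL1 R) F\<^sub>0 \<inter> centralizer (AGL1 R) F\<^sub>1\<rparr>)"
    \<comment> \<open>\<open>centralizer\<close> has the arguments of \<open>commutes\<close> in the
      opposite order to the lemma; unfolding exposes the symmetric equation.\<close>
    then have "commutes (AGL1 R) x y"
      using F by - (rule commutes_of_commutes_noncommuting[of F\<^sub>0 F\<^sub>1],
        auto simp: centralizer_def commutes_def)
    then show "x \<otimes>\<^bsub>AGL1 R \<lparr>carrier := centralizer (AGL1 R) F\<^sub>0 \<inter> centralizer (AGL1 R) F\<^sub>1\<rparr>\<^esub> y =
      y \<otimes>\<^bsub>AGL1 R \<lparr>carrier := centralizer (AGL1 R) F\<^sub>0 \<inter> centralizer (AGL1 R) F\<^sub>1\<rparr>\<^esub> x"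
      by (simp add: commutes_def)
  qed
  \<comment> \<open>In such a square the second pair would lie in the common centralizer of the
    first, hence commute.\<close>
  moreover have "\<not> cross_commuting_nonabelian_square (AGL1 R) F\<^sub>0 F\<^sub>1 G\<^sub>0 G\<^sub>1" for F\<^sub>0 F\<^sub>1 G\<^sub>0 G\<^sub>1
    using commutes_of_commutes_noncommuting[of F\<^sub>0 F\<^sub>1 G\<^sub>0 G\<^sub>1]
    by (auto simp: cross_commuting_nonabelian_square_def)
  ultimately show ?thesis
    by blast
qed

end
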